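(* Let $(V,R)$ be an irreducible root system with Weyl group $W$, and let $W_J\subset W$ be a proper parabolic subgroup. Then $$\#(W/W_J)\ \geq\ \dim V+1,$$ with equality if and only if $(V,R)$ is of type $A_n$ and $J=\{s_1,s_2,\ldots,s_{n-1}\}$ or $J=\{s_2,s_3,\ldots,s_n\}$.
   Context: $W_J$ denotes the standard parabolic subgroup of $W$ generated by a subset $J$ of the set of simple reflections (with respect to a choice of basis of $R$). For type $A_n$, $s_1,\dots,s_n$ are the simple reflections numbered consecutively along the Dynkin diagram. *)

theory Defs
  imports Complex_Main "HOL-Algebra.Generated_Groups" "HOL-Algebra.Left_Coset"
begin

text \<open>
  The vector space \<open>V\<close> of a root system \<open>(V,R)\<close> is the whole type \<open>'a\<close>, a real vector space with
  no chosen inner product; it is finite-dimensional because the finite set \<open>R\<close> spans it.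
  Thus \<open>dim V\<close> is \<^term>\<open>dim (UNIV :: 'a::real_vector set)\<close>.
\<close>

definition is_coroot :: "'a::real_vector set \<Rightarrow> 'a \<Rightarrow> ('a \<Rightarrow> real) \<Rightarrow> bool" where
  "is_coroot R \<alpha> f \<longleftrightarrow> linear f \<and> f \<alpha> = 2 \<and> (\<forall>\<beta>\<in>R. \<beta> - f \<beta> *\<^sub>R \<alpha> \<in> R)"

text \<open>
  Crystallographic and reduced. Reducedness cannot be dropped when types are to be read off from
  \<open>W\<close>: the root system \<open>{\<alpha>, -\<alpha>, 2\<alpha>, -2\<alpha>}\<close> has the same Weyl group as \<open>A\<^sub>1\<close>.
\<close>

definition root_system :: "'a::real_vector set \<Rightarrow> bool" where
  "root_system R \<longleftrightarrow>
     finite R \<and> 0 \<notin> R \<and> span R = UNIV \<and>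
     (\<forall>\<alpha>\<in>R. \<exists>f. is_coroot R \<alpha> f \<and> (\<forall>\<beta>\<in>R. f \<beta> \<in> \<int>)) \<and>
     (\<forall>\<alpha>\<in>R. \<forall>c. c *\<^sub>R \<alpha> \<in> R \<longrightarrow> c = 1 \<or> c = -1)"

text \<open>The linear form \<open>\<alpha>\<^sup>\<or>\<close>; it is unique by \<open>is_coroot_unique\<close> below.\<close>

definition coroot :: "'a::real_vector set \<Rightarrow> 'a \<Rightarrow> 'a \<Rightarrow> real" where
  "coroot R \<alpha> = (THE f. is_coroot R \<alpha> f)"

definition reflection :: "'a::real_vector set \<Rightarrow> 'a \<Rightarrow> 'a \<Rightarrow> 'a" where
  "reflection R \<alpha> = (\<lambda>x. x - coroot R \<alpha> x *\<^sub>R \<alpha>)"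

text \<open>
  \<open>R\<close> is nonempty and is not a direct sum of two nonempty root systems. If \<open>R = R1 \<union> R2\<close> with
  independent spans then \<open>R1\<close> and \<open>R2\<close> are automatically root systems in their spans, since for
  \<open>\<alpha> \<in> R1\<close>, \<open>\<beta> \<in> R2\<close> the root \<open>s\<^sub>\<alpha> \<beta>\<close> lies in one of the two spans, so that \<open>\<alpha>\<^sup>\<or>(\<beta>) = 0\<close>.
\<close>

definition irreducible_root_system :: "'a::real_vector set \<Rightarrow> bool" where
  "irreducible_root_system R \<longleftrightarrow>
     root_system R \<and> R \<noteq> {} \<and>
     \<not> (\<exists>R1 R2. R1 \<noteq> {} \<and> R2 \<noteq> {} \<and> R = R1 \<union> R2 \<and> span R1 \<inter> span R2 = {0})"

definition root_basis :: "'a::real_vector set \<Rightarrow> 'a set \<Rightarrow> bool" where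
  "root_basis R \<Delta> \<longleftrightarrow>
     \<Delta> \<subseteq> R \<and> independent \<Delta> \<and> span \<Delta> = UNIV \<and>
     (\<forall>\<beta>\<in>R. \<exists>c :: 'a \<Rightarrow> nat.
        \<beta> = (\<Sum>\<alpha>\<in>\<Delta>. real (c \<alpha>) *\<^sub>R \<alpha>) \<or> \<beta> = - (\<Sum>\<alpha>\<in>\<Delta>. real (c \<alpha>) *\<^sub>R \<alpha>))"

definition GL :: "('a::real_vector \<Rightarrow> 'a) monoid" where
  "GL = \<lparr>carrier = {g. linear g \<and> bij g}, mult = (\<circ>), one = id\<rparr>"

definition weyl_group :: "'a::real_vector set \<Rightarrow> ('a \<Rightarrow> 'a) monoid" where
  "weyl_group R = subgroup_generated GL (reflection R ` R)"

definition simple_reflections :: "'a::real_vector set \<Rightarrow> 'a set \<Rightarrow> ('a \<Rightarrow> 'a) set" where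
  "simple_reflections R \<Delta> = reflection R ` \<Delta>"

definition parabolic :: "'a::real_vector set \<Rightarrow> ('a \<Rightarrow> 'a) set \<Rightarrow> ('a \<Rightarrow> 'a) set" where
  "parabolic R J = generate (weyl_group R) J"

text \<open>
  \<open>\<alpha> 1, \<dots>, \<alpha> n\<close> enumerates the basis \<open>\<Delta>\<close> consecutively along a Dynkin diagram of type \<open>A\<^sub>n\<close>,
  i.e. the Cartan integers are those of \<open>A\<^sub>n\<close>. For irreducible \<open>R\<close>, such an enumeration
  exists for some \<open>n\<close> iff \<open>R\<close> is of type \<open>A\<^sub>n\<close>, and it is unique up to reversal.
\<close>

definition type_A_numbering :: "'a::real_vector set \<Rightarrow> 'a set \<Rightarrow> nat \<Rightarrow> (nat \<Rightarrow> 'a) \<Rightarrow> bool" where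
  "type_A_numbering R \<Delta> n \<alpha> \<longleftrightarrow>
     bij_betw \<alpha> {1..n} \<Delta> \<and>
     (\<forall>i\<in>{1..n}. \<forall>j\<in>{1..n}.
        coroot R (\<alpha> i) (\<alpha> j) = (if i = j then 2 else if i = j + 1 \<or> j = i + 1 then -1 else 0))"

lemma is_coroot_unique:
  assumes fin: "finite R" and sp: "span R = UNIV" and "\<alpha> \<noteq> 0"
    and f: "is_coroot R \<alpha> f" and g: "is_coroot R \<alpha> g"
  shows "f = g"
proof -
  have lf: "linear f" and lg: "linear g" and "f \<alpha> = 2" "g \<alpha> = 2"
    using f g by (auto simp: is_coroot_def)
  have eq: "f \<beta> = g \<beta>" if "\<beta> \<in> R" for \<beta>
  proof (rule ccontr)
    assume ne: "f \<beta> \<noteq> g \<beta>"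
    let ?h = "f \<beta> - g \<beta>"
    let ?u = "\<lambda>k::nat. \<beta> - (real k * ?h) *\<^sub>R \<alpha>"
    have "?u k \<in> R" for k
    proof (induction k)
      case 0
      then show ?case using that by simp
    next
      case (Suc k)
      let ?v = "?u k - g (?u k) *\<^sub>R \<alpha>"
      have "?v \<in> R" using Suc g by (auto simp: is_coroot_def)
      then have "?v - f ?v *\<^sub>R \<alpha> \<in> R" using f by (auto simp: is_coroot_def)
      moreover have "g (?u k) = g \<beta> - 2 * (real k * ?h)"
        using \<open>g \<alpha> = 2\<close> by (simp add: linear_diff[OF lg] linear_scale[OF lg])
      moreover have "f ?v = f \<beta> - 2 * (real k * ?h) - 2 * g (?u k)"
        using \<open>f \<alpha> = 2\<close> by (simp add: linear_diff[OF lf] linear_scale[OF lf])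
      ultimately have "real k * ?h + g (?u k) + f ?v = real (Suc k) * ?h"
        by (simp add: algebra_simps)
      moreover have "?v - f ?v *\<^sub>R \<alpha> = \<beta> - (real k * ?h + g (?u k) + f ?v) *\<^sub>R \<alpha>"
        by (simp only: scaleR_add_left diff_diff_eq add.assoc)
      ultimately show ?case using \<open>?v - f ?v *\<^sub>R \<alpha> \<in> R\<close> by (simp only:)
    qed
    then have "range ?u \<subseteq> R" by blast
    moreover have "inj ?u" using ne \<open>\<alpha> \<noteq> 0\<close> by (auto simp: inj_def)
    ultimately have "infinite R"
      using infinite_iff_countable_subset by blast
    then show False using fin by simp
  qed
  show ?thesis
  proof
    fix x show "f x = g x"
      using linear_eq_on[OF lf lg, of x R] eq sp by auto
  qed
qed

lemma is_coroot_coroot: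
  assumes "root_system R" "\<alpha> \<in> R"
  shows "is_coroot R \<alpha> (coroot R \<alpha>)"
proof -
  have "\<alpha> \<noteq> 0" using assms by (auto simp: root_system_def)
  with assms have "\<exists>!f. is_coroot R \<alpha> f"
    using is_coroot_unique[of R \<alpha>] unfolding root_system_def by metis
  then show ?thesis unfolding coroot_def by (rule theI')
qed

lemma group_GL: "group GL"
proof (rule groupI)
  fix g :: "'a \<Rightarrow> 'a" assume "g \<in> carrier GL"
  then have g: "linear g" "bij g" by (auto simp: GL_def)
  have surj: "g (inv_into UNIV g x) = x" for x
    using g by (simp add: bij_is_surj surj_f_inv_f)
  have "linear (inv_into UNIV g)"
  proof (rule linearI)
    fix x y :: 'a and c :: real
    show "inv_into UNIV g (x + y) = inv_into UNIV g x + inv_into UNIV g y"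
      using g by (intro inv_f_eq) (simp_all add: bij_is_inj linear_add surj)
    show "inv_into UNIV g (c *\<^sub>R x) = c *\<^sub>R inv_into UNIV g x"
      using g by (intro inv_f_eq) (simp_all add: bij_is_inj linear_scale surj)
  qed
  then have "inv_into UNIV g \<in> carrier GL"
    using g by (simp add: GL_def bij_imp_bij_inv)
  moreover have "inv_into UNIV g \<circ> g = id" using g by (simp add: bij_def)
  ultimately show "\<exists>y\<in>carrier GL. y \<otimes>\<^bsub>GL\<^esub> g = \<one>\<^bsub>GL\<^esub>"
    by (intro bexI[of _ "inv_into UNIV g"]) (simp_all add: GL_def)
qed (simp_all add: GL_def linear_compose bij_comp comp_assoc linear_id)

lemma reflection_in_GL:
  assumes "root_system R" "\<alpha> \<in> R"
  shows "reflection R \<alpha> \<in> carrier GL"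
proof -
  have c: "linear (coroot R \<alpha>)" "coroot R \<alpha> \<alpha> = 2"
    using is_coroot_coroot[OF assms] by (auto simp: is_coroot_def)
  have "linear (reflection R \<alpha>)"
    using c(1) by (simp add: reflection_def linear_iff algebra_simps)
  moreover have "reflection R \<alpha> (reflection R \<alpha> x) = x" for x
    using c(2) by (simp add: reflection_def linear_diff[OF c(1)] linear_scale[OF c(1)])
  then have "bij (reflection R \<alpha>)" by (rule involuntory_imp_bij)
  ultimately show ?thesis by (simp add: GL_def)
qed

end

theory Submission
  imports Defs
begin

text \<open>
  Since \<open>W\<^sub>J\<close> is proper and \<open>W\<close> is generated by the simple reflections, some simple root
  \<open>k\<close> has \<open>s\<^sub>k \<notin> J\<close>. Let \<open>\<omega>\<close> be the linear form taking a vector to its coefficient at \<open>k\<close>,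
  that is, the fundamental weight of \<open>k\<close> for the dual root system. Every element of \<open>J\<close> fixes
  \<open>\<omega>\<close>, so \<open>W\<^sub>J\<close> has at least as many cosets as the orbit \<open>O = {\<omega> \<circ> w | w \<in> W}\<close> has elements.
  The common kernel of \<open>O\<close> is \<open>W\<close>-invariant, hence zero by irreducibility, and the elements of
  \<open>O\<close> sum to zero. Already all but one of them separate points, so \<open>#O \<ge> dim V + 1\<close>. This is
  the inequality (\<open>card_orbit_ge\<close> and \<open>card_orbit_le_cosets\<close>).

  If equality holds then \<open>#O = dim V + 1\<close> and \<open>W\<^sub>J\<close> is the whole stabilizer of \<open>\<omega>\<close>. Evaluation
  identifies \<open>V\<close> with the functions on \<open>O\<close> of sum zero, and a reflection of \<open>V\<close> that
  permutes \<open>O\<close> must act as a transposition: each root is nonzero at exactly two points of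
  \<open>O\<close>, which its reflection exchanges (\<open>root_support\<close>). So the simple roots are the edges of a
  graph with vertex set \<open>O\<close>, connected because the simple reflections generate \<open>W\<close>. If two
  edges \<open>a, b\<close> meet at \<open>x\<close> then their Cartan integers are both \<open>-1\<close> and \<open>x(b) = -x(a)\<close>
  (\<open>cor_adjacent\<close>), whereas disjoint edges are orthogonal. Hence at every vertex at most one
  simple root is positive and at most one is negative. The graph is therefore a path; it starts
  at \<open>\<omega>\<close> with the edge \<open>k\<close>, and its edges in order form a diagram of type A
  (\<open>step_numbering\<close>). The simple reflections other than \<open>s\<^sub>k\<close> fix \<open>\<omega>\<close>, so they lie in
  \<open>W\<^sub>J\<close>, hence in \<open>J\<close>, which is thus \<open>{s\<^sub>2, \<dots>, s\<^sub>n}\<close>.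

  Conversely, in type A the cosets of \<open>\<langle>s\<^sub>2, \<dots>, s\<^sub>n\<rangle>\<close> represented by
  \<open>1, s\<^sub>1, s\<^sub>2 s\<^sub>1, \<dots>, s\<^sub>n \<dots> s\<^sub>1\<close> are permuted by all simple reflections, by the braid
  relations, so there are at most \<open>n + 1\<close> (\<open>card_cosets_type_A\<close>); the other set \<open>J\<close>
  is obtained by numbering the diagram backwards.
\<close>

section \<open>Monoids generated by maps\<close>

text \<open>
  All generators that occur are involutions, so products without inverses already give the
  generated group, and inductions need only one kind of step.
\<close>
inductive_set words :: "('a \<Rightarrow> 'a) set \<Rightarrow> ('a \<Rightarrow> 'a) set" for A where
  id_words: "id \<in> words A"
| step_words: "s \<in> A \<Longrightarrow> w \<in> words A \<Longrightarrow> s \<circ> w \<in> words A"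

lemma letter_in_words: "s \<in> A \<Longrightarrow> s \<in> words A"
  using step_words[OF _ id_words, of s A] by simp

lemma words_comp:
  assumes "u \<in> words A" and v: "v \<in> words A"
  shows "u \<circ> v \<in> words A"
  using assms(1)
proof (induction rule: words.induct)
  case id_words
  show ?case using v by (simp only: id_comp)
next
  case (step_words s u)
  then show ?case using words.step_words[of s A "u \<circ> v"] by (simp only: comp_assoc)
qed

lemma words_subset:
  assumes "\<And>s. s \<in> A \<Longrightarrow> s \<in> words B"
  shows "words A \<subseteq> words B"
proof
  fix w assume "w \<in> words A"
  then show "w \<in> words B"
  proof (induction rule: words.induct)
    case id_words
    show ?case by (rule words.id_words)
  next
    case (step_words s w)
    then show ?case using words_comp[of s B w] assms by blast
  qed
qed

lemma words_inverse:
  assumes "\<And>s. s \<in> A \<Longrightarrow> s \<circ> s = id" and "w \<in> words A"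
  shows "\<exists>v\<in>words A. v \<circ> w = id \<and> w \<circ> v = id"
  using assms(2)
proof (induction rule: words.induct)
  case id_words
  show ?case by (intro bexI[of _ id]) (auto intro: words.id_words)
next
  case (step_words s w)
  then obtain v where v: "v \<in> words A" "v \<circ> w = id" "w \<circ> v = id" by blast
  have "v \<circ> s \<in> words A"
    using words_comp[OF v(1) letter_in_words[OF step_words(1)]] .
  moreover have "(v \<circ> s) \<circ> (s \<circ> w) = id" "(s \<circ> w) \<circ> (v \<circ> s) = id"
    using v(2,3) assms(1)[OF step_words(1)] by (metis comp_assoc comp_id id_comp)+
  ultimately show ?case by blast
qed

text \<open>
  Precomposition with a word consumes its letters from the left, which turns the recursion on
  words into an induction along the orbit of \<open>x\<close> under the right action.
\<close>
lemma words_orbit_induct: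
  assumes "w \<in> words A" and "P x" and "\<And>s y. s \<in> A \<Longrightarrow> P y \<Longrightarrow> P (y \<circ> s)"
  shows "P (x \<circ> w)"
  using assms(1,2)
proof (induction arbitrary: x rule: words.induct)
  case (step_words s w)
  have "P ((x \<circ> s) \<circ> w)" using step_words assms(3) by blast
  then show ?case by (simp only: comp_assoc)
qed simp

section \<open>Finitely many linear forms without a common zero\<close>

lemma span_complement_of_common_kernel:
  fixes F :: "('a::real_vector \<Rightarrow> real) set"
  assumes "finite F" and "\<And>f. f \<in> F \<Longrightarrow> linear f"
  shows "\<exists>B. finite B \<and> card B \<le> card F \<and> span (B \<union> {v. \<forall>f\<in>F. f v = 0}) = UNIV"
  using assms
proof (induction rule: finite_induct)
  case empty
  show ?case by (intro exI[of _ "{}"]) simp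
next
  case (insert f F)
  let ?U = "{v. \<forall>f\<in>F. f v = 0}" and ?U' = "{v. \<forall>g\<in>insert f F. g v = 0}"
  obtain B where B: "finite B" "card B \<le> card F" "span (B \<union> ?U) = UNIV"
    using insert.IH insert.prems by auto
  have lf: "linear f" using insert.prems by simp
  show ?case
  proof (cases "\<forall>u\<in>?U. f u = 0")
    case True
    then have "?U' = ?U" by auto
    then show ?thesis
      using B insert.hyps by (intro exI[of _ B]) auto
  next
    case False
    then obtain b where b: "b \<in> ?U" "f b \<noteq> 0" by blast
    have "u \<in> span (insert b B \<union> ?U')" if u: "u \<in> ?U" for u
    proof -
      have "u - (f u / f b) *\<^sub>R b \<in> ?U'"
        using u b insert.prems by (auto simp: linear_diff linear_scale)
      then have "u - (f u / f b) *\<^sub>R b \<in> span (insert b B \<union> ?U')"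
        by (intro span_base) blast
      moreover have "(f u / f b) *\<^sub>R b \<in> span (insert b B \<union> ?U')"
        by (intro span_scale span_base) blast
      ultimately have "(u - (f u / f b) *\<^sub>R b) + (f u / f b) *\<^sub>R b \<in> span (insert b B \<union> ?U')"
        by (rule span_add)
      then show ?thesis by simp
    qed
    then have "B \<union> ?U \<subseteq> span (insert b B \<union> ?U')"
      by (auto intro: span_base)
    then have "span (insert b B \<union> ?U') = UNIV"
      using B(3) span_minimal[OF _ subspace_span] by blast
    moreover have "card (insert b B) \<le> card (insert f F)"
      using B insert.hyps card_insert_le_m1[of "Suc (card F)" B b] by (simp add: card_insert_if)
    ultimately show ?thesis using B(1) by (intro exI[of _ "insert b B"]) simp
  qed
qed

text \<open>
  Each further form lowers the dimension of the common kernel by at most one.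
\<close>
lemma dim_le_card_separating_forms:
  fixes F :: "('a::real_vector \<Rightarrow> real) set"
  assumes "finite F" and "\<And>f. f \<in> F \<Longrightarrow> linear f"
    and "\<And>v. (\<And>f. f \<in> F \<Longrightarrow> f v = 0) \<Longrightarrow> v = 0"
  shows "dim (UNIV :: 'a set) \<le> card F"
proof -
  obtain B where B: "finite B" "card B \<le> card F" "span (B \<union> {v. \<forall>f\<in>F. f v = 0}) = UNIV"
    using span_complement_of_common_kernel[OF assms(1,2)] by blast
  have "{v. \<forall>f\<in>F. f v = 0} \<subseteq> {0}" using assms(3) by auto
  then have "B \<union> {v. \<forall>f\<in>F. f v = 0} \<subseteq> insert 0 B" by auto
  then have "span (insert 0 B) = UNIV" using B(3) span_mono by blast
  then have "span B = UNIV" by simp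
  then show ?thesis using B(1,2) dim_le_card[of UNIV B] by simp
qed

section \<open>Root systems\<close>

locale roots =
  fixes R :: "'a::real_vector set"
  assumes root_system: "root_system R"
begin

abbreviation cor :: "'a \<Rightarrow> 'a \<Rightarrow> real" where "cor \<equiv> coroot R"
abbreviation refl :: "'a \<Rightarrow> 'a \<Rightarrow> 'a" where "refl \<equiv> reflection R"
abbreviation W :: "('a \<Rightarrow> 'a) set" where "W \<equiv> words (refl ` R)"

lemma finite_R: "finite R" and zero_notin_R: "0 \<notin> R" and span_R: "span R = UNIV"
  using root_system by (auto simp: root_system_def)

lemma linear_cor: "a \<in> R \<Longrightarrow> linear (cor a)"
  and cor_self: "a \<in> R \<Longrightarrow> cor a a = 2"
  and refl_root: "a \<in> R \<Longrightarrow> b \<in> R \<Longrightarrow> refl a b \<in> R"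
  using is_coroot_coroot[OF root_system] by (auto simp: is_coroot_def reflection_def)

lemma cor_eqI: "a \<in> R \<Longrightarrow> is_coroot R a f \<Longrightarrow> cor a = f"
  using is_coroot_unique[OF finite_R span_R] is_coroot_coroot[OF root_system] zero_notin_R by metis

lemma cor_Ints: "a \<in> R \<Longrightarrow> b \<in> R \<Longrightarrow> cor a b \<in> \<int>"
proof -
  assume a: "a \<in> R" and b: "b \<in> R"
  then obtain f where "is_coroot R a f" "\<forall>b\<in>R. f b \<in> \<int>"
    using root_system unfolding root_system_def by blast
  then show ?thesis using cor_eqI[OF a, of f] b by blast
qed

lemma linear_refl: "a \<in> R \<Longrightarrow> linear (refl a)"
  using reflection_in_GL[OF root_system] by (auto simp: GL_def)

lemma refl_refl: "a \<in> R \<Longrightarrow> refl a (refl a x) = x"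
  using linear_cor[of a] cor_self[of a] by (simp add: reflection_def linear_diff linear_scale)

lemma refl_comp_refl: "a \<in> R \<Longrightarrow> refl a \<circ> refl a = id"
  by (auto simp: refl_refl)

lemma refl_self: "a \<in> R \<Longrightarrow> refl a a = - a"
  using cor_self[of a] by (simp add: reflection_def scaleR_2)

lemma form_refl: "linear f \<Longrightarrow> f (refl a x) = f x - cor a x * f a"
  for f :: "'a \<Rightarrow> real"
  by (simp add: reflection_def linear_diff linear_scale)

lemma cor_refl:
  assumes a: "a \<in> R" and b: "b \<in> R"
  shows "cor (refl a b) = cor b \<circ> refl a"
proof (rule cor_eqI[OF refl_root[OF a b]])
  have lin: "linear (cor b \<circ> refl a)" using a b by (intro linear_compose linear_refl linear_cor)
  have "c - (cor b \<circ> refl a) c *\<^sub>R refl a b \<in> R" if c: "c \<in> R" for c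
  proof -
    have "refl a (refl b (refl a c)) = refl a (refl a c - cor b (refl a c) *\<^sub>R b)"
      by (simp add: reflection_def[of R b])
    also have "\<dots> = c - cor b (refl a c) *\<^sub>R refl a b"
      using linear_refl[OF a] by (simp add: linear_diff linear_scale refl_refl[OF a])
    finally show ?thesis using a b c by (metis comp_apply refl_root)
  qed
  then show "is_coroot R (refl a b) (cor b \<circ> refl a)"
    using lin a b by (auto simp: is_coroot_def refl_refl cor_self)
qed

lemma refl_conj:
  assumes a: "a \<in> R" and b: "b \<in> R"
  shows "refl (refl a b) = refl a \<circ> refl b \<circ> refl a"
proof
  fix x
  have "refl a (refl b (refl a x)) = refl a (refl a x - cor b (refl a x) *\<^sub>R b)"
    by (simp add: reflection_def[of R b])
  also have "\<dots> = x - cor b (refl a x) *\<^sub>R refl a b"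
    using linear_refl[OF a] by (simp add: linear_diff linear_scale refl_refl[OF a])
  also have "\<dots> = refl (refl a b) x"
    using cor_refl[OF a b] by (simp add: reflection_def[of R "refl a b"])
  finally show "refl (refl a b) x = (refl a \<circ> refl b \<circ> refl a) x" by simp
qed

lemma uminus_root: "a \<in> R \<Longrightarrow> - a \<in> R" and refl_uminus: "a \<in> R \<Longrightarrow> refl (- a) = refl a"
proof -
  assume a: "a \<in> R"
  show "- a \<in> R" using refl_root[OF a a] refl_self[OF a] by simp
  show "refl (- a) = refl a"
    using refl_conj[OF a a] refl_self[OF a] refl_comp_refl[OF a] by simp
qed

lemma sum_refl_reindex: "a \<in> R \<Longrightarrow> (\<Sum>c\<in>R. g (refl a c)) = (\<Sum>c\<in>R. g c)"
  for g :: "'a \<Rightarrow> 'b::comm_monoid_add"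
  by (rule sum.reindex_bij_witness[of _ "refl a" "refl a"]) (auto simp: refl_refl refl_root)

text \<open>
  An invariant symmetric bilinear form; on roots it is what makes \<open>cor a b = 0\<close> symmetric and
  gives the positivity needed to lower the height of a positive root.
\<close>
definition ip :: "'a \<Rightarrow> 'a \<Rightarrow> real" where
  "ip x y = (\<Sum>c\<in>R. cor c x * cor c y)"

lemma ip_commute: "ip x y = ip y x"
  by (simp add: ip_def mult.commute)

lemma linear_ip: "linear (ip x)"
  unfolding ip_def
  by (intro linear_compose_sum ballI linear_compose_scale_right[where 'b=real, unfolded real_scaleR_def] linear_cor)

lemma ip_refl: "a \<in> R \<Longrightarrow> ip (refl a x) (refl a y) = ip x y"
  unfolding ip_def using sum_refl_reindex[of a "\<lambda>c. cor c x * cor c y"]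
  by (simp add: cor_refl)

lemma ip_pos: "a \<in> R \<Longrightarrow> ip a a > 0"
  unfolding ip_def using cor_self[of a]
  by (intro sum_pos2[of _ a]) (auto simp: finite_R)

text \<open>
  The form is invariant under \<open>refl a\<close>, which negates \<open>a\<close>. So coroots are the usual normalized
  inner products with roots.
\<close>
lemma two_ip:
  assumes a: "a \<in> R" shows "2 * ip a x = cor a x * ip a a"
proof -
  have "ip a x = ip (- a) (refl a x)" using ip_refl[OF a, of a x] refl_self[OF a] by simp
  also have "\<dots> = - ip a (refl a x)"
    using linear_neg[OF linear_ip, of "refl a x" a] by (simp add: ip_commute)
  also have "\<dots> = - (ip a x - cor a x * ip a a)" using form_refl[OF linear_ip] by simp
  finally show ?thesis by simp
qed

lemma cor_zero_sym: "a \<in> R \<Longrightarrow> b \<in> R \<Longrightarrow> cor a b = 0 \<Longrightarrow> cor b a = 0"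
  using two_ip[of a b] two_ip[of b a] ip_pos[of b] by (simp add: ip_commute)

lemma W_linear: "w \<in> W \<Longrightarrow> linear w"
proof (induction rule: words.induct)
  case id_words
  show ?case by (rule linear_id)
next
  case (step_words s w)
  then show ?case using linear_compose[of w s] linear_refl by blast
qed

lemma W_root: "w \<in> W \<Longrightarrow> c \<in> R \<Longrightarrow> w c \<in> R"
  by (induction rule: words.induct) (auto intro: refl_root)

lemma finite_W: "finite W"
proof (rule inj_on_finite)
  show "finite (R \<rightarrow>\<^sub>E R)" using finite_R by (intro finite_PiE)
  show "(\<lambda>w. restrict w R) ` W \<subseteq> R \<rightarrow>\<^sub>E R" using W_root by auto
  show "inj_on (\<lambda>w. restrict w R) W"
  proof (rule inj_onI, rule ext)
    fix u v x assume u: "u \<in> W" and v: "v \<in> W" and eq: "restrict u R = restrict v R"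
    have "u c = v c" if "c \<in> R" for c using fun_cong[OF eq, of c] that by simp
    then show "u x = v x"
      using linear_eq_on[OF W_linear[OF u] W_linear[OF v], of x R] span_R by auto
  qed
qed

text \<open>
  Such a vector \<open>v\<close> is fixed by \<open>W\<close>, so summing over \<open>W\<close> multiplies it by the order of \<open>W\<close>.
  On the other hand the sum kills every root \<open>a\<close>, because the terms \<open>w a\<close> and
  \<open>(w \<circ> refl a) a\<close> cancel, and hence is zero.
\<close>
lemma zero_if_coroots_vanish:
  assumes v: "\<And>a. a \<in> R \<Longrightarrow> cor a v = 0"
  shows "v = 0"
proof -
  let ?S = "\<lambda>x. \<Sum>w\<in>W. w x"
  have lin: "linear ?S" by (rule linear_compose_sum) (simp add: W_linear)
  have "?S a = 0" if a: "a \<in> R" for a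
  proof -
    have "?S a = (\<Sum>w\<in>W. (w \<circ> refl a) a)"
      by (rule sum.reindex_bij_witness[of _ "\<lambda>w. w \<circ> refl a" "\<lambda>w. w \<circ> refl a"])
        (use a in \<open>simp_all add: comp_assoc refl_comp_refl refl_refl words_comp letter_in_words\<close>)
    also have "\<dots> = (\<Sum>w\<in>W. - w a)"
      using a by (intro sum.cong) (auto simp: refl_self W_linear linear_neg)
    finally have "?S a = - ?S a" by (simp add: sum_negf)
    then have "2 *\<^sub>R ?S a = 0" by (metis scaleR_2 eq_neg_iff_add_eq_0)
    then show ?thesis by simp
  qed
  then have "?S v = 0"
    using linear_eq_on[OF lin linear_zero, of v R] span_R by auto
  moreover have "w v = v" if "w \<in> W" for w using that
    by (induction rule: words.induct) (auto simp: v reflection_def)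
  then have "?S v = (\<Sum>w\<in>W. v)" by (rule sum.cong[OF HOL.refl])
  then have "?S v = real (card W) *\<^sub>R v" by (simp only: sum_constant_scaleR)
  moreover have "card W \<noteq> 0" using finite_W id_words by auto
  ultimately show ?thesis by simp
qed

end

text \<open>
  An invariant subspace contains each root or lies in the kernel of its coroot. This splits
  \<open>R\<close> into the roots inside \<open>K\<close> and the roots outside, and the two parts are orthogonal: a vector in
  both spans is killed by all coroots, so the spans are independent.
\<close>
lemma (in roots) invariant_subspace_trivial:
  assumes irr: "irreducible_root_system R"
    and K: "subspace K" "\<And>a v. a \<in> R \<Longrightarrow> v \<in> K \<Longrightarrow> refl a v \<in> K"
  shows "K = {0} \<or> K = UNIV"
proof -
  have dich: "cor a v = 0" if "a \<in> R" "a \<notin> K" "v \<in> K" for a v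
  proof (rule ccontr)
    assume ne: "cor a v \<noteq> 0"
    have "v - refl a v \<in> K" using that K by (intro subspace_diff) auto
    then have "(1 / cor a v) *\<^sub>R (v - refl a v) \<in> K" by (rule subspace_scale[OF K(1)])
    moreover have "(1 / cor a v) *\<^sub>R (v - refl a v) = a" using ne by (simp add: reflection_def)
    ultimately show False using that by simp
  qed
  let ?R1 = "R \<inter> K" and ?R2 = "R - K"
  have "span ?R1 \<inter> span ?R2 \<subseteq> {0}"
  proof
    fix v assume v: "v \<in> span ?R1 \<inter> span ?R2"
    have vK: "v \<in> K" using v span_minimal[of ?R1 K] K(1) by blast
    have "cor a v = 0" if a: "a \<in> R" for a
    proof (cases "a \<in> K")
      case True
      have "cor a b = 0" if "b \<in> ?R2" for b
        using that True a dich[of b a] cor_zero_sym[of b a] by auto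
      then show ?thesis
        using linear_eq_0_on_span[OF linear_cor[OF a], of ?R2 v] v by blast
    next
      case False
      then show ?thesis using dich a vK by blast
    qed
    then show "v \<in> {0}" using zero_if_coroots_vanish by blast
  qed
  then have "span ?R1 \<inter> span ?R2 = {0}" using span_zero by blast
  then have "?R1 = {} \<or> ?R2 = {}"
    using irr unfolding irreducible_root_system_def by (metis Int_Diff_Un)
  then show ?thesis
  proof
    assume "?R1 = {}"
    then have "K \<subseteq> {0}" using dich zero_if_coroots_vanish by blast
    then show ?thesis using subspace_0[OF K(1)] by blast
  next
    assume "?R2 = {}"
    then have "span R \<subseteq> K" using span_minimal[OF _ K(1)] by blast
    then show ?thesis using span_R by auto
  qed
qed

section \<open>Bases\<close>

locale based_roots = roots +
  fixes \<Delta> :: "'a set"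
  assumes basis: "root_basis R \<Delta>"
begin

abbreviation S :: "('a \<Rightarrow> 'a) set" where "S \<equiv> refl ` \<Delta>"

lemma base_sub: "\<Delta> \<subseteq> R" and indep_base: "independent \<Delta>" and base_span: "span \<Delta> = UNIV"
  using basis by (auto simp: root_basis_def)

lemma base_root: "a \<in> \<Delta> \<Longrightarrow> a \<in> R" using base_sub by blast

lemma finite_base: "finite \<Delta>" using base_sub finite_R finite_subset by blast

lemma dim_base: "dim (UNIV :: 'a set) = card \<Delta>"
  using dim_eq_card_independent[OF indep_base] dim_span[of \<Delta>] base_span by simp

definition coord :: "'a \<Rightarrow> 'a \<Rightarrow> real" where
  "coord a = (SOME f. linear f \<and> (\<forall>b\<in>\<Delta>. f b = (if b = a then 1 else 0)))"

lemma coord: "linear (coord a) \<and> (\<forall>b\<in>\<Delta>. coord a b = (if b = a then 1 else 0))"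
  using someI_ex[OF linear_independent_extend[OF indep_base, of "\<lambda>b. if b = a then 1 else 0 :: real"]]
  unfolding coord_def by blast

lemma linear_coord: "linear (coord a)"
  and coord_base: "b \<in> \<Delta> \<Longrightarrow> coord a b = (if b = a then 1 else 0)"
  using coord by auto

lemma coord_expansion: "x = (\<Sum>a\<in>\<Delta>. coord a x *\<^sub>R a)"
proof -
  have "linear (\<lambda>x. \<Sum>a\<in>\<Delta>. coord a x *\<^sub>R a)"
    by (intro linear_compose_sum ballI linearI)
      (simp_all add: linear_add[OF linear_coord] linear_scale[OF linear_coord] scaleR_left_distrib)
  moreover have "b = (\<Sum>a\<in>\<Delta>. coord a b *\<^sub>R a)" if "b \<in> \<Delta>" for b
  proof -
    have "(\<Sum>a\<in>\<Delta>. coord a b *\<^sub>R a) = (\<Sum>a\<in>\<Delta>. if a = b then a else 0)"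
      using that by (intro sum.cong) (auto simp: coord_base)
    then show ?thesis using that finite_base by simp
  qed
  ultimately show ?thesis
    using linear_eq_on[OF linear_id, of "\<lambda>x. \<Sum>a\<in>\<Delta>. coord a x *\<^sub>R a" x \<Delta>] base_span by auto
qed

lemma coord_sum:
  assumes "a \<in> \<Delta>" shows "coord a (\<Sum>b\<in>\<Delta>. g b *\<^sub>R b) = g a"
proof -
  have "coord a (\<Sum>b\<in>\<Delta>. g b *\<^sub>R b) = (\<Sum>b\<in>\<Delta>. if b = a then g b else 0)"
    by (simp add: linear_sum[OF linear_coord] linear_scale[OF linear_coord] coord_base
        if_distrib cong: sum.cong if_cong)
  then show ?thesis using assms finite_base by simp
qed

lemma root_sign:
  assumes "b \<in> R"
  shows "(\<forall>a\<in>\<Delta>. coord a b \<ge> 0) \<or> (\<forall>a\<in>\<Delta>. coord a b \<le> 0)"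
proof -
  obtain c :: "'a \<Rightarrow> nat" where
    "b = (\<Sum>\<alpha>\<in>\<Delta>. real (c \<alpha>) *\<^sub>R \<alpha>) \<or> b = - (\<Sum>\<alpha>\<in>\<Delta>. real (c \<alpha>) *\<^sub>R \<alpha>)"
    using basis assms unfolding root_basis_def by blast
  then show ?thesis
    by (auto simp: coord_sum linear_neg[OF linear_coord])
qed

text \<open>
  The coefficients of \<open>refl a b\<close> at \<open>b\<close> and \<open>a\<close> are \<open>1\<close> and \<open>- cor a b\<close>, and they cannot have
  opposite signs.
\<close>
lemma cor_base_nonpos:
  assumes "a \<in> \<Delta>" "b \<in> \<Delta>" "a \<noteq> b"
  shows "cor a b \<le> 0"
proof -
  have "refl a b \<in> R" using assms base_root refl_root by blast
  moreover have "coord b (refl a b) = 1" "coord a (refl a b) = - cor a b"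
    using assms by (auto simp: form_refl[OF linear_coord] coord_base)
  ultimately show ?thesis using root_sign[of "refl a b"] assms by force
qed

text \<open>
  Induction on the height. A positive root \<open>b\<close> has positive inner product with some simple root
  \<open>a\<close> of its support; if \<open>b\<close> is not simple, then \<open>refl a b\<close> is again positive, of smaller height,
  and its reflection is conjugate to that of \<open>b\<close> by \<open>refl a\<close>.
\<close>
lemma refl_in_words_simple_pos:
  assumes "b \<in> R" "\<forall>a\<in>\<Delta>. coord a b \<ge> 0" "(\<Sum>a\<in>\<Delta>. coord a b) \<le> real n"
  shows "refl b \<in> words S"
  using assms
proof (induction n arbitrary: b)
  case 0
  then have "(\<Sum>a\<in>\<Delta>. coord a b) = 0" by (simp add: antisym sum_nonneg)
  then have "\<forall>a\<in>\<Delta>. coord a b = 0"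
    using 0 finite_base by (simp add: sum_nonneg_eq_0_iff)
  then have "(\<Sum>a\<in>\<Delta>. coord a b *\<^sub>R a) = 0" by simp
  then have "b = 0" using coord_expansion[of b] by metis
  then show ?case using 0 zero_notin_R by simp
next
  case (Suc n)
  show ?case
  proof (cases "b \<in> \<Delta>")
    case True
    then show ?thesis by (intro letter_in_words) simp
  next
    case False
    have "\<exists>a\<in>\<Delta>. coord a b * ip b a > 0"
    proof (rule ccontr)
      assume "\<not> ?thesis"
      then have "(\<Sum>a\<in>\<Delta>. coord a b * ip b a) \<le> 0" by (intro sum_nonpos) force
      moreover have "ip b b = (\<Sum>a\<in>\<Delta>. coord a b * ip b a)"
        by (subst (2) coord_expansion[of b])
          (simp add: linear_sum[OF linear_ip] linear_scale[OF linear_ip])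
      ultimately show False using ip_pos Suc.prems(1) by force
    qed
    then obtain a where a: "a \<in> \<Delta>" and pos: "coord a b * ip b a > 0" by blast
    then have "coord a b > 0" "ip b a > 0"
      using Suc.prems(2) by (auto simp: zero_less_mult_iff dest: bspec)
    have aR: "a \<in> R" using a base_root by blast
    have "cor a b * ip a a > 0" using two_ip[OF aR, of b] \<open>ip b a > 0\<close> by (simp add: ip_commute)
    then have "cor a b > 0" using ip_pos[OF aR] by (simp add: zero_less_mult_iff)
    then have m: "cor a b \<ge> 1"
      using cor_Ints[OF aR Suc.prems(1)] by (auto elim!: Ints_cases)
    \<comment> \<open>Reflecting in \<open>a\<close> leaves this second coefficient unchanged, so the sign of the root survives.\<close>
    have "\<exists>a'\<in>\<Delta>. a' \<noteq> a \<and> coord a' b > 0"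
    proof (rule ccontr)
      assume "\<not> ?thesis"
      then have z: "\<forall>a'\<in>\<Delta>. a' \<noteq> a \<longrightarrow> coord a' b = 0"
        using Suc.prems(2) by force
      have "b = (\<Sum>a'\<in>\<Delta>. if a' = a then coord a b *\<^sub>R a else 0)"
        by (subst coord_expansion[of b], rule sum.cong) (use z in auto)
      then have b: "b = coord a b *\<^sub>R a" using a finite_base by simp
      then have "coord a b *\<^sub>R a \<in> R" using Suc.prems(1) by simp
      then have "coord a b = 1 \<or> coord a b = - 1"
        using root_system aR unfolding root_system_def by blast
      then have "coord a b = 1" using \<open>coord a b > 0\<close> by simp
      then show False using b a False by simp
    qed
    then obtain a' where a': "a' \<in> \<Delta>" "a' \<noteq> a" "coord a' b > 0" by blast
    let ?c = "refl a b"
    have c: "?c \<in> R" using refl_root aR Suc.prems by blast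
    have co: "coord e ?c = coord e b - cor a b * (if e = a then 1 else 0)" if "e \<in> \<Delta>" for e
      using that a by (auto simp: form_refl[OF linear_coord] coord_base)
    have "coord a' ?c > 0" using co a' by simp
    then have cpos: "\<forall>e\<in>\<Delta>. coord e ?c \<ge> 0" using root_sign[OF c] a' by force
    have "(\<Sum>e\<in>\<Delta>. coord e ?c) = (\<Sum>e\<in>\<Delta>. coord e b) - (\<Sum>e\<in>\<Delta>. if e = a then cor a b else 0)"
      unfolding sum_subtractf[symmetric] by (rule sum.cong) (auto simp: co)
    also have "\<dots> = (\<Sum>e\<in>\<Delta>. coord e b) - cor a b" using a finite_base by simp
    finally have "(\<Sum>e\<in>\<Delta>. coord e ?c) \<le> real n" using m Suc.prems(3) by simp
    then have "refl ?c \<in> words S" using Suc.IH c cpos by blast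
    moreover have "refl b = refl a \<circ> refl ?c \<circ> refl a"
      using refl_conj[OF aR c] refl_refl[OF aR] by simp
    ultimately show ?thesis using a by (metis words_comp letter_in_words imageI)
  qed
qed

lemma W_eq_words_simple: "W = words S"
proof
  show "words S \<subseteq> W" using base_root by (intro words_subset letter_in_words) auto
  have "refl b \<in> words S" if b: "b \<in> R" for b
  proof -
    have pos: "refl c \<in> words S" if "c \<in> R" "\<forall>a\<in>\<Delta>. coord a c \<ge> 0" for c
      using refl_in_words_simple_pos[OF that] real_arch_simple by blast
    show ?thesis
    proof (cases "\<forall>a\<in>\<Delta>. coord a b \<ge> 0")
      case False
      then have "\<forall>a\<in>\<Delta>. coord a (- b) \<ge> 0"
        using root_sign[OF b] by (auto simp: linear_neg[OF linear_coord])
      then show ?thesis using pos[OF uminus_root[OF b]] refl_uminus[OF b] by simp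
    qed (use pos b in blast)
  qed
  then show "W \<subseteq> words S" by (intro words_subset) auto
qed

end

section \<open>The orbit of a fundamental weight\<close>

locale weight_orbit = based_roots +
  fixes k :: 'a
  assumes irr: "irreducible_root_system R" and k_base: "k \<in> \<Delta>"
begin

definition orbit :: "('a \<Rightarrow> real) set" where
  "orbit = (\<lambda>w. coord k \<circ> w) ` W"

lemma finite_orbit: "finite orbit"
  using finite_W by (simp add: orbit_def)

lemma coord_in_orbit: "coord k \<in> orbit"
  unfolding orbit_def using id_words by (intro image_eqI[of _ _ id]) auto

lemma linear_orbit: "x \<in> orbit \<Longrightarrow> linear x"
  unfolding orbit_def using linear_compose[OF W_linear linear_coord] by blast

lemma orbit_refl:
  assumes "x \<in> orbit" "a \<in> R" shows "x \<circ> refl a \<in> orbit"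
proof -
  obtain w where w: "w \<in> W" "x = coord k \<circ> w" using assms unfolding orbit_def by blast
  have "w \<circ> refl a \<in> W" using w assms by (intro words_comp letter_in_words[of "refl a"]) auto
  moreover have "x \<circ> refl a = coord k \<circ> (w \<circ> refl a)" using w by (simp only: comp_assoc)
  ultimately show ?thesis unfolding orbit_def by blast
qed

lemma refl_form: "x \<in> orbit \<Longrightarrow> (x \<circ> refl a) v = x v - cor a v * x a"
  using form_refl[OF linear_orbit] by simp

lemma refl_form_self: "x \<in> orbit \<Longrightarrow> a \<in> R \<Longrightarrow> (x \<circ> refl a) a = - x a"
  using refl_form[of x a a] cor_self[of a] by simp

lemma comp_refl_refl: "a \<in> R \<Longrightarrow> x \<circ> refl a \<circ> refl a = x" for x :: "'a \<Rightarrow> real"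
  by (simp only: comp_assoc refl_comp_refl comp_id)

text \<open>
  Precomposition with \<open>refl a\<close> permutes the orbit, so the sum at \<open>a\<close> equals its own negative.
\<close>
lemma sum_orbit: "(\<Sum>x\<in>orbit. x v) = 0"
proof -
  have lin: "linear (\<lambda>v. \<Sum>x\<in>orbit. x v)" by (rule linear_compose_sum) (simp add: linear_orbit)
  have "(\<Sum>x\<in>orbit. x a) = 0" if a: "a \<in> R" for a
  proof -
    have "(\<Sum>x\<in>orbit. x a) = (\<Sum>x\<in>orbit. (x \<circ> refl a) a)"
      by (rule sum.reindex_bij_witness[of _ "\<lambda>x. x \<circ> refl a" "\<lambda>x. x \<circ> refl a"])
        (simp_all only: comp_refl_refl[OF a] orbit_refl a)
    also have "\<dots> = (\<Sum>x\<in>orbit. - x a)"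
      using a by (intro sum.cong) (simp_all only: refl_form_self)
    finally show ?thesis by (simp add: sum_negf)
  qed
  then show ?thesis using linear_eq_0_on_span[OF lin, of R v] span_R by auto
qed

text \<open>
  The common kernel of the orbit is an invariant subspace that does not contain \<open>k\<close>.
\<close>
lemma orbit_separates:
  assumes "\<And>x. x \<in> orbit \<Longrightarrow> x v = 0"
  shows "v = 0"
proof -
  let ?K = "{v. \<forall>x\<in>orbit. x v = 0}"
  have "subspace ?K"
    unfolding subspace_def using linear_orbit by (auto simp: linear_0 linear_add linear_scale)
  moreover have "refl a v \<in> ?K" if "a \<in> R" "v \<in> ?K" for a v
    using that orbit_refl[OF _ that(1)] by (auto simp: comp_def)
  ultimately have "?K = {0} \<or> ?K = UNIV"
    using invariant_subspace_trivial[OF irr, of ?K] by blast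
  moreover have "k \<notin> ?K" using coord_in_orbit coord_base[OF k_base, of k] by force
  ultimately show ?thesis using assms by blast
qed

lemma orbit_minus_one_separates:
  assumes x: "x \<in> orbit" and zero: "\<And>y. y \<in> orbit - {x} \<Longrightarrow> y v = 0"
  shows "v = 0"
proof -
  have "0 = x v + (\<Sum>y\<in>orbit - {x}. y v)"
    using sum_orbit[of v] sum.remove[OF finite_orbit x, of "\<lambda>y. y v"] by simp
  also have "(\<Sum>y\<in>orbit - {x}. y v) = 0" using zero by (intro sum.neutral) blast
  finally show ?thesis using zero by (intro orbit_separates) force
qed

lemma card_orbit_ge: "dim (UNIV :: 'a set) + 1 \<le> card orbit"
proof -
  have "dim (UNIV :: 'a set) \<le> card (orbit - {coord k})"
    using orbit_minus_one_separates[OF coord_in_orbit] finite_orbit linear_orbit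
    by (intro dim_le_card_separating_forms) auto
  moreover have "card orbit > 0" using coord_in_orbit finite_orbit card_gt_0_iff by blast
  ultimately show ?thesis using coord_in_orbit by simp
qed

end

locale minimal_orbit = weight_orbit +
  assumes card_orbit: "card orbit = dim (UNIV :: 'a set) + 1"
begin

text \<open>
  Evaluation embeds the space into the functions on the orbit of sum zero. Here the dimensions
  agree, so the function that is \<open>1\<close> at \<open>x\<close>, \<open>-1\<close> at \<open>y\<close> and zero elsewhere is attained.
\<close>
lemma difference_vector:
  assumes xy: "x \<in> orbit" "y \<in> orbit" "x \<noteq> y"
  obtains v where "x v = 1" "y v = -1" "\<And>z. z \<in> orbit \<Longrightarrow> z \<noteq> x \<Longrightarrow> z \<noteq> y \<Longrightarrow> z v = 0"
proof -
  let ?F = "orbit - {x, y}"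
  have "card {x, y} \<le> card orbit" using xy finite_orbit by (intro card_mono) auto
  moreover have "card ?F = card orbit - 2" using xy finite_orbit by (subst card_Diff_subset) auto
  ultimately have "\<not> dim (UNIV :: 'a set) \<le> card ?F" using card_orbit xy by simp
  then obtain v where v: "\<forall>z\<in>?F. z v = 0" "v \<noteq> 0"
    using dim_le_card_separating_forms[of ?F] finite_orbit linear_orbit by (metis DiffD1 finite_Diff)
  have "x v \<noteq> 0"
    using orbit_minus_one_separates[OF xy(2), of v] v by blast
  have "(\<Sum>z\<in>orbit. z v) = x v + (\<Sum>z\<in>orbit - {x}. z v)"
    using finite_orbit xy by (intro sum.remove)
  also have "(\<Sum>z\<in>orbit - {x}. z v) = y v + (\<Sum>z\<in>orbit - {x} - {y}. z v)"
    using finite_orbit xy by (intro sum.remove) auto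
  also have "(\<Sum>z\<in>orbit - {x} - {y}. z v) = 0" using v by (intro sum.neutral) blast
  finally have "y v = - x v" using sum_orbit[of v] by simp
  show ?thesis
  proof (rule that[of "(1 / x v) *\<^sub>R v"])
    show "x ((1 / x v) *\<^sub>R v) = 1" "y ((1 / x v) *\<^sub>R v) = -1"
      using \<open>x v \<noteq> 0\<close> \<open>y v = - x v\<close> xy
      by (simp_all add: linear_scale[OF linear_orbit[OF xy(1)]] linear_scale[OF linear_orbit[OF xy(2)]])
    fix z assume "z \<in> orbit" "z \<noteq> x" "z \<noteq> y"
    then show "z ((1 / x v) *\<^sub>R v) = 0" using v linear_scale[OF linear_orbit, of z] by simp
  qed
qed

text \<open>
  For \<open>x\<close> in the support of \<open>a\<close>, the difference \<open>x - x \<circ> refl a\<close> is a nonzero multiple of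
  the coroot. A third point \<open>z\<close> of the support would express the coroot by \<open>z\<close> and
  \<open>z \<circ> refl a\<close> as well, and this is refuted by the vector separating \<open>x\<close> from \<open>x \<circ> refl a\<close>.
\<close>
lemma root_support:
  assumes a: "a \<in> R" and x: "x \<in> orbit" "x a \<noteq> 0" and z: "z \<in> orbit" "z a \<noteq> 0"
  shows "z = x \<or> z = x \<circ> refl a"
proof (rule ccontr)
  assume "\<not> ?thesis"
  then have zx: "z \<noteq> x" and zy: "z \<noteq> x \<circ> refl a" by auto
  have y: "x \<circ> refl a \<in> orbit" "x \<noteq> x \<circ> refl a"
    using orbit_refl x a refl_form_self[OF x(1) a] by force+
  obtain v where v: "x v = 1" "(x \<circ> refl a) v = -1"
      "\<And>z. z \<in> orbit \<Longrightarrow> z \<noteq> x \<Longrightarrow> z \<noteq> x \<circ> refl a \<Longrightarrow> z v = 0"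
    using difference_vector[OF x(1) y] by blast
  have "cor a v * x a = 2" using refl_form[OF x(1), of a v] v by simp
  then have "cor a v \<noteq> 0" by auto
  moreover have "z \<circ> refl a \<noteq> x" "z \<circ> refl a \<noteq> x \<circ> refl a"
    using zx zy comp_refl_refl[OF a] by metis+
  then have "(z \<circ> refl a) v = 0" using v(3) orbit_refl[OF z(1) a] by blast
  then have "cor a v * z a = 0" using refl_form[OF z(1), of a v] v(3)[OF z(1) zx zy] by simp
  ultimately show False using z by simp
qed

lemma form_nonzero:
  assumes "a \<in> R" obtains x where "x \<in> orbit" "x a \<noteq> 0"
  using orbit_separates[of a] assms zero_notin_R by metis

text \<open>
  Two simple roots cannot have both support points in common, or they would be proportional as
  functions on the orbit. So \<open>b\<close> vanishes at \<open>x \<circ> refl a\<close>, whose value at \<open>b\<close> is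
  \<open>x b - cor a b * x a\<close>.
\<close>
lemma cor_meeting:
  assumes ab: "a \<in> \<Delta>" "b \<in> \<Delta>" "a \<noteq> b" and x: "x \<in> orbit" "x a \<noteq> 0" "x b \<noteq> 0"
  shows "cor a b * x a = x b"
proof -
  have aR: "a \<in> R" and bR: "b \<in> R" using ab base_root by auto
  let ?y = "x \<circ> refl a"
  have y: "?y \<in> orbit" "?y a = - x a" using orbit_refl refl_form_self x aR by auto
  have "?y b = 0"
  proof (rule ccontr)
    assume "?y b \<noteq> 0"
    moreover have "?y \<noteq> x"
    proof
      assume "?y = x"
      then have "x a = - x a" using y(2) by metis
      then show False using x(2) by simp
    qed
    ultimately have eq: "?y = x \<circ> refl b" using root_support[OF bR x(1,3) y(1)] by blast
    then have yb: "?y b = - x b" using refl_form_self[OF x(1) bR] by simp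
    have "z (x b *\<^sub>R a - x a *\<^sub>R b) = 0" if z: "z \<in> orbit" for z
    proof -
      have lz: "z (x b *\<^sub>R a - x a *\<^sub>R b) = x b * z a - x a * z b"
        using linear_orbit[OF z] by (simp add: linear_diff linear_scale)
      show ?thesis
      proof (cases "z = x \<or> z = ?y")
        case True
        then show ?thesis using lz y yb by (elim disjE) (simp_all del: comp_apply)
      next
        case False
        then have "z a = 0" "z b = 0"
          using root_support[OF aR x(1,2) z] root_support[OF bR x(1,3) z] unfolding eq by blast+
        then show ?thesis using lz by simp
      qed
    qed
    then have "x b *\<^sub>R a - x a *\<^sub>R b = 0" by (rule orbit_separates)
    then have "coord a (x b *\<^sub>R a - x a *\<^sub>R b) = 0" using linear_0[OF linear_coord] by simp
    then show False
      using ab x by (simp add: linear_diff[OF linear_coord] linear_scale[OF linear_coord] coord_base)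
  qed
  then show ?thesis using refl_form[OF x(1), of a b] by simp
qed

text \<open>
  The two Cartan integers are \<open>x b / x a\<close> and its inverse, and they are nonpositive.
\<close>
lemma cor_adjacent:
  assumes ab: "a \<in> \<Delta>" "b \<in> \<Delta>" "a \<noteq> b" and x: "x \<in> orbit" "x a \<noteq> 0" "x b \<noteq> 0"
  shows "cor a b = -1" "x b = - x a"
proof -
  have aR: "a \<in> R" and bR: "b \<in> R" using ab base_root by auto
  have p: "cor a b * x a = x b" and q: "cor b a * x b = x a"
    using cor_meeting[OF ab x] cor_meeting[of b a x] ab x by auto
  obtain m n where mn: "cor a b = of_int m" "cor b a = of_int n"
    using cor_Ints[OF aR bR] cor_Ints[OF bR aR] by (auto elim!: Ints_cases)
  have "cor a b * cor b a = 1"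
    using p q x(2) by (metis mult.assoc mult.commute mult_cancel_right1)
  then have "m * n = 1" using mn by (metis of_int_eq_1_iff of_int_mult)
  moreover have "m \<le> 0" using mn cor_base_nonpos[OF ab] by simp
  ultimately have "m = -1" using zmult_eq_1_iff by force
  then show "cor a b = -1" using mn by simp
  then show "x b = - x a" using p by simp
qed

lemma cor_disjoint:
  assumes ab: "a \<in> R" and disj: "\<And>x. x \<in> orbit \<Longrightarrow> x a = 0 \<or> x b = 0"
  shows "cor a b = 0"
proof -
  obtain x where x: "x \<in> orbit" "x a \<noteq> 0" using form_nonzero ab by blast
  have "(x \<circ> refl a) a \<noteq> 0" using refl_form_self[OF x(1) ab] x by simp
  then have "(x \<circ> refl a) b = 0" "x b = 0" using disj orbit_refl x ab by blast+
  then show ?thesis using refl_form[OF x(1), of a b] x by simp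
qed

lemma positive_unique:
  "x \<in> orbit \<Longrightarrow> a \<in> \<Delta> \<Longrightarrow> b \<in> \<Delta> \<Longrightarrow> x a > 0 \<Longrightarrow> x b > 0 \<Longrightarrow> a = b"
  using cor_adjacent(2)[of a b x] by force

lemma negative_unique:
  "x \<in> orbit \<Longrightarrow> a \<in> \<Delta> \<Longrightarrow> b \<in> \<Delta> \<Longrightarrow> x a < 0 \<Longrightarrow> x b < 0 \<Longrightarrow> a = b"
  using cor_adjacent(2)[of a b x] by force

text \<open>
  One move along the path: reflect in the simple root that is positive at \<open>x\<close>, of which there is at
  most one. The final vertex of the path is a fixed point.
\<close>
definition down :: "('a \<Rightarrow> real) \<Rightarrow> 'a \<Rightarrow> real" where
  "down x = (if \<exists>a\<in>\<Delta>. x a > 0 then x \<circ> refl (SOME a. a \<in> \<Delta> \<and> x a > 0) else x)"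

definition path :: "nat \<Rightarrow> 'a \<Rightarrow> real" where
  "path i = (down ^^ i) (coord k)"

lemma path_0: "path 0 = coord k" and path_Suc: "path (Suc i) = down (path i)"
  by (simp_all add: path_def)

lemma down_eq:
  assumes "x \<in> orbit" "a \<in> \<Delta>" "x a > 0" shows "down x = x \<circ> refl a"
proof -
  have "(SOME a. a \<in> \<Delta> \<and> x a > 0) = a"
  proof (rule some_equality)
    show "b = a" if "b \<in> \<Delta> \<and> x b > 0" for b
      using that assms positive_unique by blast
  qed (use assms in blast)
  then show ?thesis using assms unfolding down_def by auto
qed

lemma path_orbit: "path i \<in> orbit"
proof (induction i)
  case 0
  show ?case using coord_in_orbit path_0 by simp
next
  case (Suc i)
  show ?case
  proof (cases "\<exists>a\<in>\<Delta>. path i a > 0")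
    case True
    then obtain a where a: "a \<in> \<Delta>" "path i a > 0" by blast
    show ?thesis unfolding path_Suc down_eq[OF Suc a] by (rule orbit_refl[OF Suc base_root[OF a(1)]])
  next
    case False
    then have "path (Suc i) = path i" by (auto simp: path_Suc down_def)
    then show ?thesis using Suc by simp
  qed
qed

text \<open>
  Reflecting in the simple root that is positive at a vertex moves forward, reflecting in the negative one
  moves back to where the path came from, and every other simple reflection fixes the vertex. At the
  starting point \<open>coord k\<close> no simple root is negative.
\<close>
lemma path_refl: "a \<in> \<Delta> \<Longrightarrow> path i \<circ> refl a \<in> range path"
proof (induction i)
  case 0
  have nn: "path 0 a \<ge> 0" using 0 by (simp add: path_0 coord_base)
  show ?case
  proof (cases "path 0 a = 0")
    case True
    then have "path 0 \<circ> refl a = path 0" using refl_form[OF path_orbit] by auto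
    then show ?thesis by simp
  next
    case False
    then have "path (Suc 0) = path 0 \<circ> refl a"
      using down_eq[OF path_orbit 0] nn path_Suc[of 0] by force
    then show ?thesis by (metis rangeI)
  qed
next
  case (Suc i)
  note a = Suc.prems
  consider "path (Suc i) a = 0" | "path (Suc i) a > 0" | "path (Suc i) a < 0" by linarith
  then show ?case
  proof cases
    case 1
    then have "path (Suc i) \<circ> refl a = path (Suc i)" using refl_form[OF path_orbit] by auto
    then show ?thesis by simp
  next
    case 2
    then have "path (Suc (Suc i)) = path (Suc i) \<circ> refl a"
      using down_eq[OF path_orbit a 2] path_Suc[of "Suc i"] by metis
    then show ?thesis by (metis rangeI)
  next
    case 3
    show ?thesis
    proof (cases "\<exists>b\<in>\<Delta>. path i b > 0")
      case False
      then have "path (Suc i) = path i" by (auto simp: path_Suc down_def)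
      then show ?thesis using Suc by simp
    next
      case True
      then obtain b where b: "b \<in> \<Delta>" "path i b > 0" by blast
      have eq: "path (Suc i) = path i \<circ> refl b" using down_eq[OF path_orbit b] path_Suc by metis
      then have "path (Suc i) b < 0" using refl_form_self[OF path_orbit base_root[OF b(1)], of i] b by simp
      then have "a = b" using negative_unique[OF path_orbit a b(1) 3] by blast
      then have "path (Suc i) \<circ> refl a = path i" using eq comp_refl_refl[OF base_root[OF a], of "path i"] by simp
      then show ?thesis by simp
    qed
  qed
qed

lemma orbit_eq_path: "orbit = range path"
proof
  show "range path \<subseteq> orbit" using path_orbit by blast
  have "coord k \<circ> w \<in> range path" if w: "w \<in> words S" for w
  proof (rule words_orbit_induct[OF w])
    show "coord k \<in> range path" using path_0 by (metis rangeI)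
    show "y \<circ> s \<in> range path" if "s \<in> S" "y \<in> range path" for s and y :: "'a \<Rightarrow> real"
      using that path_refl by blast
  qed
  then show "orbit \<subseteq> range path" unfolding orbit_def W_eq_words_simple by blast
qed

text \<open>
  The path is the sequence of iterates of a map, so it is periodic from its first repetition on.
\<close>
lemma path_repeats:
  assumes "i < j" "path i = path j"
  shows "range path \<subseteq> path ` {..<j}"
proof -
  have "path m \<in> path ` {..<j}" for m
  proof (induction m rule: less_induct)
    case (less m)
    show ?case
    proof (cases "m < j")
      case False
      have "path m = (down ^^ (m - j)) (path j)"
        using False by (simp add: path_def funpow_add[symmetric, THEN fun_cong, unfolded comp_def])
      also have "\<dots> = path (m - j + i)"
        unfolding assms(2)[symmetric] by (simp add: path_def funpow_add)
      finally show ?thesis using less[of "m - j + i"] False assms(1) by simp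
    qed auto
  qed
  then show ?thesis by blast
qed

lemma path_inj: "inj_on path {..card \<Delta>}"
proof -
  have "path i \<noteq> path j" if ij: "i < j" "j \<le> card \<Delta>" for i j
  proof
    assume "path i = path j"
    then have "orbit \<subseteq> path ` {..<j}" using path_repeats ij orbit_eq_path by simp
    then have "card orbit \<le> card (path ` {..<j})" by (intro card_mono) auto
    also have "\<dots> \<le> j" using card_image_le[of "{..<j}" path] by simp
    finally show False using ij card_orbit dim_base by simp
  qed
  then show ?thesis unfolding inj_on_def by (metis atMost_iff linorder_neqE_nat)
qed

text \<open>
  The edge from vertex \<open>i - 1\<close> to vertex \<open>i\<close> of the path; edges are counted from \<open>1\<close>, like the nodes of
  the Dynkin diagram.
\<close>
definition step :: "nat \<Rightarrow> 'a" where
  "step i = (SOME a. a \<in> \<Delta> \<and> path (i - 1) a > 0)"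

context
  fixes i assumes i: "i \<in> {1..card \<Delta>}"
begin

lemma step: "step i \<in> \<Delta>" "path (i - 1) (step i) > 0"
proof -
  have "i - 1 \<in> {..card \<Delta>}" "i \<in> {..card \<Delta>}" "i - 1 \<noteq> i" using i by auto
  then have "path (i - 1) \<noteq> path i" using path_inj by (metis inj_onD)
  moreover have "path i = down (path (i - 1))" using path_Suc[of "i - 1"] i by simp
  ultimately have "\<exists>a. a \<in> \<Delta> \<and> path (i - 1) a > 0" unfolding down_def by metis
  then have "step i \<in> \<Delta> \<and> path (i - 1) (step i) > 0" unfolding step_def by (rule someI_ex)
  then show "step i \<in> \<Delta>" "path (i - 1) (step i) > 0" by auto
qed

lemma path_step: "path i = path (i - 1) \<circ> refl (step i)"
  using down_eq[OF path_orbit step] path_Suc[of "i - 1"] i by simp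

lemma path_step_neg: "path i (step i) < 0"
  using path_step refl_form_self[OF path_orbit base_root[OF step(1)], of "i - 1"] step(2) by simp

lemma step_support: "x \<in> orbit \<Longrightarrow> x (step i) \<noteq> 0 \<Longrightarrow> x = path (i - 1) \<or> x = path i"
  using root_support[OF base_root[OF step(1)] path_orbit, of "i - 1" x] step(2) path_step by simp

end

lemma bij_step: "bij_betw step {1..card \<Delta>} \<Delta>"
proof -
  have inj: "inj_on step {1..card \<Delta>}"
  proof (rule inj_onI)
    fix i j assume i: "i \<in> {1..card \<Delta>}" and j: "j \<in> {1..card \<Delta>}" and eq: "step i = step j"
    have pos: "path (i - 1) (step j) > 0" using step(2)[OF i] eq by simp
    then have "path (i - 1) \<noteq> path j" using path_step_neg[OF j] by force
    then have "path (i - 1) = path (j - 1)"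
      using step_support[OF j path_orbit, of "i - 1"] pos by force
    then have "i - 1 = j - 1" using inj_onD[OF path_inj, of "i - 1" "j - 1"] i j by auto
    then show "i = j" using i j by auto
  qed
  moreover have "step ` {1..card \<Delta>} = \<Delta>"
    using step(1) card_image[OF inj] finite_base by (intro card_subset_eq) auto
  ultimately show ?thesis unfolding bij_betw_def by blast
qed

text \<open>
  The vertices of the path are distinct, so two edges share a vertex exactly when they are
  consecutive.
\<close>
lemma step_numbering: "type_A_numbering R \<Delta> (card \<Delta>) step"
  unfolding type_A_numbering_def
proof (intro conjI ballI bij_step)
  fix i j assume i: "i \<in> {1..card \<Delta>}" and j: "j \<in> {1..card \<Delta>}"
  note si = step[OF i] and sj = step[OF j]
  have ne: "step i \<noteq> step j" if "i \<noteq> j"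
    using bij_step i j that unfolding bij_betw_def by (metis inj_onD)
  consider "i = j" | "i = j + 1" | "j = i + 1" | "i \<noteq> j" "i \<noteq> j + 1" "j \<noteq> i + 1" by meson
  then show "cor (step i) (step j) = (if i = j then 2 else if i = j + 1 \<or> j = i + 1 then -1 else 0)"
  proof cases
    case 1
    then show ?thesis using cor_self[OF base_root[OF sj(1)]] by (simp only: HOL.refl if_True)
  next
    case 2
    then have "i - 1 = j" "i \<noteq> j" by auto
    then have "path j (step i) > 0" using si(2) by metis
    then have "cor (step i) (step j) = -1"
      using cor_adjacent(1)[OF si(1) sj(1) ne[OF \<open>i \<noteq> j\<close>] path_orbit, of j] path_step_neg[OF j] by simp
    then show ?thesis using 2 by simp
  next
    case 3
    then have "j - 1 = i" "i \<noteq> j" by auto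
    then have "path i (step j) > 0" using sj(2) by metis
    then have "cor (step i) (step j) = -1"
      using cor_adjacent(1)[OF si(1) sj(1) ne[OF \<open>i \<noteq> j\<close>] path_orbit, of i] path_step_neg[OF i] by simp
    then show ?thesis using 3 by simp
  next
    case 4
    have "cor (step i) (step j) = 0"
    proof (rule cor_disjoint[OF base_root[OF si(1)]], rule ccontr)
      fix x assume x: "x \<in> orbit" and "\<not> (x (step i) = 0 \<or> x (step j) = 0)"
      then have "x = path (i - 1) \<or> x = path i" "x = path (j - 1) \<or> x = path j"
        using step_support[OF i x] step_support[OF j x] by auto
      then have "\<exists>m\<in>{i - 1, i}. \<exists>l\<in>{j - 1, j}. path m = path l" by auto
      then obtain m l where ml: "m \<in> {i - 1, i}" "l \<in> {j - 1, j}" "path m = path l" by blast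
      moreover have "m \<in> {..card \<Delta>}" "l \<in> {..card \<Delta>}" using ml(1,2) i j by auto
      ultimately have "m = l" using path_inj by (metis inj_onD)
      then show False using ml 4 i j by auto
    qed
    then show ?thesis using 4 by simp
  qed
qed

lemma step_1: "step 1 = k"
proof -
  have "card \<Delta> > 0" using k_base finite_base card_gt_0_iff by blast
  then have "1 \<in> {1..card \<Delta>}" by simp
  note s = step[OF this]
  have "coord k (step 1) > 0" using s(2) path_0 by simp
  then show ?thesis using s(1) coord_base[OF s(1), of k] by (auto split: if_splits)
qed

end

section \<open>Cosets of a parabolic subgroup\<close>

lemma generate_eq_words:
  fixes G :: "('a \<Rightarrow> 'a) monoid"
  assumes G: "Group.group G" and mult: "mult G = (\<circ>)" and one: "one G = id"
    and A: "A \<subseteq> carrier G" and inv: "\<And>s. s \<in> A \<Longrightarrow> s \<circ> s = id"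
  shows "generate G A = words A"
proof
  have inv_eq: "inv\<^bsub>G\<^esub> s = s" if "s \<in> A" for s
    using that A inv mult one group.inv_equality[OF G, of s s] by auto
  show "generate G A \<subseteq> words A"
  proof
    fix g assume "g \<in> generate G A"
    then show "g \<in> words A"
    proof (induction rule: generate.induct)
      case one
      show ?case unfolding assms(3) by (rule id_words)
    next
      case (incl h)
      then show ?case by (rule letter_in_words)
    next
      case (inv h)
      then show ?case unfolding inv_eq[OF inv] by (rule letter_in_words)
    next
      case (eng h1 h2)
      then show ?case unfolding mult by (intro words_comp)
    qed
  qed
  show "words A \<subseteq> generate G A"
  proof
    fix w assume "w \<in> words A"
    then show "w \<in> generate G A"
    proof (induction rule: words.induct)
      case id_words
      show ?case by (metis generate.one one)
    next
      case (step_words s w)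
      then show ?case by (metis generate.eng generate.incl mult)
    qed
  qed
qed

context roots
begin

lemma weyl_group_ops: "mult (weyl_group R) = (\<circ>)" "one (weyl_group R) = id"
  by (simp_all add: weyl_group_def subgroup_generated_def GL_def)

lemma carrier_weyl_group: "carrier (weyl_group R) = W"
proof -
  have sub: "refl ` R \<subseteq> carrier GL" using reflection_in_GL[OF root_system] by blast
  have "carrier (weyl_group R) = generate GL (refl ` R)"
    using sub by (simp add: weyl_group_def subgroup_generated_def Int_absorb1)
  also have "\<dots> = W"
    by (rule generate_eq_words[OF group_GL _ _ sub]) (auto simp: GL_def refl_refl)
  finally show ?thesis .
qed

lemma parabolic_eq_words:
  assumes "J \<subseteq> refl ` R"
  shows "parabolic R J = words J"
  unfolding parabolic_def
proof (rule generate_eq_words)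
  show "Group.group (weyl_group R)"
    unfolding weyl_group_def by (rule group.group_subgroup_generated[OF group_GL])
  show "J \<subseteq> carrier (weyl_group R)"
    unfolding carrier_weyl_group using assms letter_in_words by blast
  show "s \<circ> s = id" if "s \<in> J" for s using that assms refl_comp_refl by blast
qed (rule weyl_group_ops)+

lemma lcosets_weyl_group:
  "lcosets\<^bsub>weyl_group R\<^esub> H = (\<lambda>w. (\<circ>) w ` H) ` W"
  unfolding LCOSETS_def l_coset_def carrier_weyl_group weyl_group_ops by blast

lemma finite_lcosets: "finite (lcosets\<^bsub>weyl_group R\<^esub> H)"
  unfolding lcosets_weyl_group using finite_W by blast

end

context based_roots
begin

lemma coord_parabolic:
  assumes J: "J \<subseteq> S" "refl b \<notin> J" and h: "h \<in> words J"
  shows "coord b \<circ> h = coord b"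
proof (rule words_orbit_induct[OF h, where P = "\<lambda>y. y = coord b"])
  fix s y assume s: "s \<in> J" and y: "y = coord b"
  obtain c where c: "c \<in> \<Delta>" "s = refl c" using s J by blast
  then have "c \<noteq> b" using s J by blast
  then show "y \<circ> s = coord b"
    using c y coord_base[OF c(1), of b] by (auto simp: form_refl[OF linear_coord])
qed simp

text \<open>
  The form \<open>coord b\<close> is fixed by the parabolic subgroup if \<open>refl b \<notin> J\<close>, but \<open>refl b\<close> moves it.
\<close>
lemma simple_in_parabolic:
  assumes "J \<subseteq> S" "b \<in> \<Delta>" "refl b \<in> words J"
  shows "refl b \<in> J"
proof (rule ccontr)
  assume "refl b \<notin> J"
  then have "coord b \<circ> refl b = coord b" using coord_parabolic assms by blast
  then have "coord b (refl b b) = coord b b" by (metis comp_apply)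
  then show False
    using assms(2) refl_self[OF base_root] by (simp add: linear_neg[OF linear_coord] coord_base)
qed

end

context weight_orbit
begin

lemma orbit_carried_to_coord:
  assumes "x \<in> orbit" obtains w where "w \<in> W" "x \<circ> w = coord k"
proof -
  obtain v where v: "v \<in> W" "x = coord k \<circ> v" using assms unfolding orbit_def by blast
  obtain w where w: "w \<in> W" "v \<circ> w = id"
    using words_inverse[OF _ v(1)] refl_comp_refl by blast
  have "x \<circ> w = coord k" using v w by (simp only: comp_assoc comp_id)
  then show ?thesis using that w by blast
qed

text \<open>
  The group acts on forms from the right, so the left coset attached to \<open>x = coord k \<circ> v\<close> is the one of
  the inverse of \<open>v\<close>: the elements that carry \<open>x\<close> back to \<open>coord k\<close>.
\<close>
definition carry :: "('a \<Rightarrow> real) \<Rightarrow> 'a \<Rightarrow> 'a" where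
  "carry x = (SOME w. w \<in> W \<and> x \<circ> w = coord k)"

lemma carry:
  assumes "x \<in> orbit" shows "carry x \<in> W \<and> x \<circ> carry x = coord k"
proof -
  have "\<exists>w. w \<in> W \<and> x \<circ> w = coord k" using orbit_carried_to_coord[OF assms] by blast
  then show ?thesis unfolding carry_def by (rule someI_ex)
qed

lemma carried_unique:
  fixes x y :: "'a \<Rightarrow> real"
  assumes "w \<in> W" "x \<circ> w = y \<circ> w" shows "x = y"
proof -
  obtain v where "w \<circ> v = id" using words_inverse[OF _ assms(1)] refl_comp_refl by blast
  then show ?thesis using assms(2) by (metis comp_assoc comp_id)
qed

context
  fixes J assumes J: "J \<subseteq> S" "refl k \<notin> J"
begin

lemma inj_coset: "inj_on (\<lambda>x. (\<circ>) (carry x) ` words J) orbit"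
proof (rule inj_onI)
  fix x y assume x: "x \<in> orbit" and y: "y \<in> orbit"
    and eq: "(\<circ>) (carry x) ` words J = (\<circ>) (carry y) ` words J"
  have "carry x \<in> (\<circ>) (carry x) ` words J" using id_words by (metis comp_id imageI)
  then obtain h where h: "h \<in> words J" "carry x = carry y \<circ> h" using eq by blast
  have "y \<circ> carry x = (y \<circ> carry y) \<circ> h" using h by (simp only: comp_assoc)
  also have "\<dots> = x \<circ> carry x" using carry x y coord_parabolic[OF J h(1)] by metis
  finally show "x = y" using carried_unique carry[OF x] by metis
qed

lemma coset_image: "(\<lambda>x. (\<circ>) (carry x) ` words J) ` orbit \<subseteq> lcosets\<^bsub>weyl_group R\<^esub> (words J)"
proof
  fix C assume "C \<in> (\<lambda>x. (\<circ>) (carry x) ` words J) ` orbit"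
  then obtain x where x: "x \<in> orbit" and C: "C = (\<circ>) (carry x) ` words J" by (rule imageE)
  show "C \<in> lcosets\<^bsub>weyl_group R\<^esub> (words J)"
    unfolding C lcosets_weyl_group using carry[OF x] by (intro imageI) (rule conjunct1)
qed

lemma card_orbit_le_cosets: "card orbit \<le> card (lcosets\<^bsub>weyl_group R\<^esub> (words J))"
  using card_inj_on_le[OF inj_coset coset_image finite_lcosets] .

text \<open>
  With no more cosets than orbit points, every coset is attached to a point. The coset of an element
  fixing \<open>coord k\<close> is attached to \<open>coord k\<close> itself, and so is the coset of the identity.
\<close>
lemma stabilizer_if_few_cosets:
  assumes card: "card (lcosets\<^bsub>weyl_group R\<^esub> (words J)) \<le> card orbit"
    and w: "w \<in> W" "coord k \<circ> w = coord k"
  shows "w \<in> words J"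
proof -
  have "card ((\<lambda>x. (\<circ>) (carry x) ` words J) ` orbit) = card (lcosets\<^bsub>weyl_group R\<^esub> (words J))"
    by (rule trans[OF card_image[OF inj_coset] le_antisym[OF card_orbit_le_cosets card]])
  then have all: "(\<lambda>x. (\<circ>) (carry x) ` words J) ` orbit = lcosets\<^bsub>weyl_group R\<^esub> (words J)"
    using coset_image finite_lcosets by (intro card_subset_eq)
  have *: "\<exists>h\<in>words J. u = carry (coord k) \<circ> h" if u: "u \<in> W" "coord k \<circ> u = coord k" for u
  proof -
    have "(\<circ>) u ` words J \<in> lcosets\<^bsub>weyl_group R\<^esub> (words J)"
      unfolding lcosets_weyl_group using u(1) by (rule imageI)
    then obtain x where x: "x \<in> orbit" "(\<circ>) u ` words J = (\<circ>) (carry x) ` words J"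
      using all by (metis (no_types, lifting) imageE)
    have "u \<in> (\<circ>) u ` words J" using id_words by (metis comp_id imageI)
    then obtain h where h: "h \<in> words J" "u = carry x \<circ> h" using x by blast
    have "x \<circ> u = (x \<circ> carry x) \<circ> h" using h by (simp only: comp_assoc)
    also have "\<dots> = coord k \<circ> u" using carry[OF x(1)] coord_parabolic[OF J h(1)] u(2) by metis
    finally have "x = coord k" using carried_unique[OF u(1)] by blast
    then show ?thesis using h by blast
  qed
  obtain h where h: "h \<in> words J" "id = carry (coord k) \<circ> h"
    using *[of id] id_words comp_id by metis
  obtain h' where h': "h' \<in> words J" "w = carry (coord k) \<circ> h'" using *[OF w] by blast
  have inv: "s \<circ> s = id" if "s \<in> J" for s
    using that J refl_comp_refl[OF base_root] by blast
  obtain g where g: "g \<in> words J" "h \<circ> g = id" using words_inverse[OF inv h(1)] by blast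
  have "carry (coord k) = g" using h g by (metis comp_assoc comp_id id_comp)
  then show ?thesis using words_comp[OF g(1) h'(1)] h' by simp
qed

end

end

section \<open>Cosets in type A\<close>

lemma (in roots) refl_commute:
  assumes a: "a \<in> R" and b: "b \<in> R" and z: "cor a b = 0"
  shows "refl a \<circ> refl b = refl b \<circ> refl a"
proof -
  have "refl a b = b" using z by (simp add: reflection_def)
  then have "refl b = refl a \<circ> refl b \<circ> refl a" using refl_conj[OF a b] by simp
  then have "refl b \<circ> refl a = refl a \<circ> refl b \<circ> (refl a \<circ> refl a)" by (metis comp_assoc)
  then show ?thesis using refl_comp_refl[OF a] by simp
qed

lemma (in roots) refl_braid:
  assumes a: "a \<in> R" and b: "b \<in> R" and c: "cor a b = -1" "cor b a = -1"
  shows "refl a \<circ> refl b \<circ> refl a = refl b \<circ> refl a \<circ> refl b"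
proof -
  have "refl a b = refl b a" using c by (simp add: reflection_def add.commute)
  then show ?thesis using refl_conj[OF a b] refl_conj[OF b a] by simp
qed

context
  fixes s :: "nat \<Rightarrow> 'a \<Rightarrow> 'a" and n :: nat
  assumes inv: "\<And>i. i \<in> {1..n} \<Longrightarrow> s i \<circ> s i = id"
    and commute: "\<And>i j. i \<in> {1..n} \<Longrightarrow> j \<in> {1..n} \<Longrightarrow> i + 2 \<le> j \<Longrightarrow> s i \<circ> s j = s j \<circ> s i"
    and braid: "\<And>i. 1 \<le> i \<Longrightarrow> Suc i \<le> n \<Longrightarrow>
      s i \<circ> s (Suc i) \<circ> s i = s (Suc i) \<circ> s i \<circ> s (Suc i)"
begin

text \<open>
  The element \<open>s\<^sub>m \<dots> s\<^sub>1\<close>, which in the symmetric group moves the first point to position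
  \<open>m + 1\<close>.
\<close>
primrec rep :: "nat \<Rightarrow> 'a \<Rightarrow> 'a" where
  "rep 0 = id"
| "rep (Suc m) = s (Suc m) \<circ> rep m"

lemma rep_commute_above: "m + 2 \<le> j \<Longrightarrow> j \<le> n \<Longrightarrow> s j \<circ> rep m = rep m \<circ> s j"
proof (induction m)
  case (Suc m)
  have "s j \<circ> rep (Suc m) = (s j \<circ> s (Suc m)) \<circ> rep m" by (simp only: rep.simps comp_assoc)
  also have "s j \<circ> s (Suc m) = s (Suc m) \<circ> s j"
    using Suc.prems by (intro commute[symmetric]) auto
  also have "s (Suc m) \<circ> s j \<circ> rep m = s (Suc m) \<circ> (s j \<circ> rep m)" by (simp only: comp_assoc)
  also have "s j \<circ> rep m = rep m \<circ> s j" using Suc.prems by (intro Suc.IH) auto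
  also have "s (Suc m) \<circ> (rep m \<circ> s j) = rep (Suc m) \<circ> s j" by (simp only: rep.simps comp_assoc)
  finally show ?case .
qed simp

text \<open>
  Move \<open>s\<^sub>j\<close> to the right past the letters that commute with it, replace \<open>s\<^sub>j s\<^sub>j\<^sub>+\<^sub>1 s\<^sub>j\<close> by
  \<open>s\<^sub>j\<^sub>+\<^sub>1 s\<^sub>j s\<^sub>j\<^sub>+\<^sub>1\<close>, and move the last \<open>s\<^sub>j\<^sub>+\<^sub>1\<close> to the right past the rest.
\<close>
lemma rep_shift: "1 \<le> j \<Longrightarrow> j < m \<Longrightarrow> m \<le> n \<Longrightarrow> s j \<circ> rep m = rep m \<circ> s (Suc j)"
proof (induction m)
  case (Suc m)
  show ?case
  proof (cases "j = m")
    case True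
    then obtain l where l: "j = Suc l" "m = Suc l" using Suc.prems by (cases m) auto
    have "s j \<circ> rep (Suc m) = (s j \<circ> s (Suc j) \<circ> s j) \<circ> rep l"
      using l by (simp only: rep.simps comp_assoc)
    also have "\<dots> = s (Suc j) \<circ> s j \<circ> (s (Suc j) \<circ> rep l)"
      using braid[of j] Suc.prems True by (simp only: comp_assoc)
    also have "s (Suc j) \<circ> rep l = rep l \<circ> s (Suc j)"
      using l Suc.prems by (intro rep_commute_above) auto
    also have "s (Suc j) \<circ> s j \<circ> (rep l \<circ> s (Suc j)) = rep (Suc m) \<circ> s (Suc j)"
      using l by (simp only: rep.simps comp_assoc)
    finally show ?thesis .
  next
    case False
    have "s j \<circ> rep (Suc m) = (s j \<circ> s (Suc m)) \<circ> rep m" by (simp only: rep.simps comp_assoc)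
    also have "s j \<circ> s (Suc m) = s (Suc m) \<circ> s j"
      using Suc.prems False by (intro commute) auto
    also have "s (Suc m) \<circ> s j \<circ> rep m = s (Suc m) \<circ> (s j \<circ> rep m)" by (simp only: comp_assoc)
    also have "s j \<circ> rep m = rep m \<circ> s (Suc j)"
      using Suc.prems False by (intro Suc.IH) auto
    also have "s (Suc m) \<circ> (rep m \<circ> s (Suc j)) = rep (Suc m) \<circ> s (Suc j)"
      by (simp only: rep.simps comp_assoc)
    finally show ?thesis .
  qed
qed simp

text \<open>
  Left multiplication by a letter sends the coset of \<open>rep m\<close> to that of \<open>rep (m + 1)\<close> or
  \<open>rep (m - 1)\<close>, or preserves it: the letter then passes to the right end and comes out with an index of at
  least \<open>2\<close>.
\<close>
lemma words_type_A_coset: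
  assumes "w \<in> words (s ` {1..n})"
  shows "\<exists>m\<le>n. \<exists>h\<in>words (s ` {2..n}). w = rep m \<circ> h"
  using assms
proof (induction rule: words.induct)
  case id_words
  show ?case by (intro exI[of _ 0] conjI bexI[of _ id] words.id_words) auto
next
  case (step_words t w)
  then obtain j m h where j: "j \<in> {1..n}" "t = s j"
    and m: "m \<le> n" and h: "h \<in> words (s ` {2..n})" "w = rep m \<circ> h" by blast
  have tw: "t \<circ> w = (s j \<circ> rep m) \<circ> h" using j h by (simp only: comp_assoc)
  have absorb: ?case if i: "i \<in> {2..n}" and eq: "s j \<circ> rep m = rep m \<circ> s i" for i
  proof -
    have "t \<circ> w = rep m \<circ> (s i \<circ> h)" using tw eq by (simp only: comp_assoc)
    moreover have "s i \<circ> h \<in> words (s ` {2..n})" using i h by (intro words.step_words) auto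
    ultimately show ?thesis using m by blast
  qed
  consider "j = Suc m" | "j = m" | "m + 2 \<le> j" | "j < m" by linarith
  then show ?case
  proof cases
    case 1
    then have "t \<circ> w = rep (Suc m) \<circ> h" unfolding tw by simp
    moreover have "Suc m \<le> n" using j 1 by simp
    ultimately show ?thesis using h(1) by blast
  next
    case 2
    then obtain l where l: "m = Suc l" using j by (cases m) auto
    have "t \<circ> w = (s j \<circ> s j) \<circ> rep l \<circ> h" using tw l 2 by (simp only: rep.simps comp_assoc)
    then have "t \<circ> w = rep l \<circ> h" unfolding inv[OF j(1)] by simp
    moreover have "l \<le> n" using m l by simp
    ultimately show ?thesis using h(1) by blast
  next
    case 3
    then show ?thesis using absorb[OF _ rep_commute_above[of m j]] j by simp
  next
    case 4
    then show ?thesis using absorb[OF _ rep_shift[of j m]] j m by simp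
  qed
qed

end

context based_roots
begin

lemma card_cosets_type_A:
  assumes num: "type_A_numbering R \<Delta> n \<alpha>"
  shows "card (lcosets\<^bsub>weyl_group R\<^esub> (words ((\<lambda>i. refl (\<alpha> i)) ` {2..n}))) \<le> n + 1"
proof -
  let ?s = "\<lambda>i. refl (\<alpha> i)"
  let ?P = "words (?s ` {2..n})"
  let ?r = "rep ?s"
  have bij: "bij_betw \<alpha> {1..n} \<Delta>"
    and cor: "\<And>i j. i \<in> {1..n} \<Longrightarrow> j \<in> {1..n} \<Longrightarrow> cor (\<alpha> i) (\<alpha> j) =
      (if i = j then 2 else if i = j + 1 \<or> j = i + 1 then -1 else 0)"
    using num unfolding type_A_numbering_def by auto
  have root: "\<alpha> i \<in> R" if "i \<in> {1..n}" for i
    using bij that base_root by (auto simp: bij_betw_def)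
  have S: "S = ?s ` {1..n}" using bij by (auto simp: bij_betw_def)
  have decomp: "\<exists>m\<le>n. \<exists>h\<in>?P. w = ?r m \<circ> h" if "w \<in> W" for w
  proof (rule words_type_A_coset)
    show "w \<in> words (?s ` {1..n})" using that unfolding W_eq_words_simple S .
    show "?s i \<circ> ?s i = id" if "i \<in> {1..n}" for i using refl_comp_refl root that by blast
    show "?s i \<circ> ?s j = ?s j \<circ> ?s i" if "i \<in> {1..n}" "j \<in> {1..n}" "i + 2 \<le> j" for i j
      using that cor[of i j] by (intro refl_commute root) auto
    show "?s i \<circ> ?s (Suc i) \<circ> ?s i = ?s (Suc i) \<circ> ?s i \<circ> ?s (Suc i)" if "1 \<le> i" "Suc i \<le> n" for i
      using that cor[of i "Suc i"] cor[of "Suc i" i] by (intro refl_braid root) auto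
  qed
  have inv: "t \<circ> t = id" if "t \<in> ?s ` {2..n}" for t
    using that refl_comp_refl root by fastforce
  have absorb: "(\<circ>) h ` ?P = ?P" if h: "h \<in> ?P" for h
  proof
    show "(\<circ>) h ` ?P \<subseteq> ?P" using words_comp h by blast
    obtain g where g: "g \<in> ?P" "h \<circ> g = id" using words_inverse[OF inv h] by blast
    show "?P \<subseteq> (\<circ>) h ` ?P"
    proof
      fix x assume "x \<in> ?P"
      then have "g \<circ> x \<in> ?P" using g words_comp by blast
      moreover have "x = h \<circ> (g \<circ> x)" using g by (metis comp_assoc id_comp)
      ultimately show "x \<in> (\<circ>) h ` ?P" by blast
    qed
  qed
  have "lcosets\<^bsub>weyl_group R\<^esub> ?P \<subseteq> (\<lambda>m. (\<circ>) (?r m) ` ?P) ` {..n}"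
  proof
    fix C assume "C \<in> lcosets\<^bsub>weyl_group R\<^esub> ?P"
    then obtain w where w: "w \<in> W" "C = (\<circ>) w ` ?P" unfolding lcosets_weyl_group by blast
    then obtain m h where m: "m \<le> n" "h \<in> ?P" "w = ?r m \<circ> h" using decomp by blast
    have "C = (\<circ>) (?r m) ` ((\<circ>) h ` ?P)" using w m by (simp add: image_image comp_assoc)
    then show "C \<in> (\<lambda>m. (\<circ>) (?r m) ` ?P) ` {..n}" using absorb[OF m(2)] m(1) by auto
  qed
  then have "card (lcosets\<^bsub>weyl_group R\<^esub> ?P) \<le> card ((\<lambda>m. (\<circ>) (?r m) ` ?P) ` {..n})"
    by (intro card_mono) auto
  also have "\<dots> \<le> card {..n}" by (intro card_image_le) auto
  finally show ?thesis by simp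
qed

end

lemma type_A_numbering_reverse:
  assumes "type_A_numbering R \<Delta> n \<alpha>"
  shows "type_A_numbering R \<Delta> n (\<lambda>i. \<alpha> (n + 1 - i))"
proof -
  have "bij_betw (\<lambda>i. n + 1 - i) {1..n} {1..n}"
    by (rule bij_betw_byWitness[where f' = "\<lambda>i. n + 1 - i"]) auto
  then have "bij_betw (\<lambda>i. \<alpha> (n + 1 - i)) {1..n} \<Delta>"
    using assms bij_betw_trans[of "\<lambda>i. n + 1 - i" _ _ \<alpha>]
    unfolding type_A_numbering_def comp_def by blast
  moreover have "coroot R (\<alpha> (n + 1 - i)) (\<alpha> (n + 1 - j)) =
      (if i = j then 2 else if i = j + 1 \<or> j = i + 1 then -1 else 0)"
    if "i \<in> {1..n}" "j \<in> {1..n}" for i j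
  proof -
    have "n + 1 - i \<in> {1..n}" "n + 1 - j \<in> {1..n}" using that by auto
    then have "coroot R (\<alpha> (n + 1 - i)) (\<alpha> (n + 1 - j)) =
      (if n + 1 - i = n + 1 - j then 2
       else if n + 1 - i = n + 1 - j + 1 \<or> n + 1 - j = n + 1 - i + 1 then -1 else 0)"
      using assms unfolding type_A_numbering_def by blast
    moreover have "n + 1 - i = n + 1 - j \<longleftrightarrow> i = j"
      "n + 1 - i = n + 1 - j + 1 \<longleftrightarrow> j = i + 1" "n + 1 - j = n + 1 - i + 1 \<longleftrightarrow> i = j + 1"
      using that by auto
    ultimately show ?thesis by auto
  qed
  ultimately show ?thesis unfolding type_A_numbering_def by blast
qed

section \<open>The bound and the case of equality\<close>

theorem proposition5p2p13:
  fixes R \<Delta> :: "'a::real_vector set" and J :: "('a \<Rightarrow> 'a) set"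
  assumes "irreducible_root_system R"
    and "root_basis R \<Delta>"
    and "J \<subseteq> simple_reflections R \<Delta>"
    and "parabolic R J \<noteq> carrier (weyl_group R)"
  shows "card (lcosets\<^bsub>weyl_group R\<^esub> parabolic R J) \<ge> dim (UNIV :: 'a set) + 1
    \<and> (card (lcosets\<^bsub>weyl_group R\<^esub> parabolic R J) = dim (UNIV :: 'a set) + 1 \<longleftrightarrow>
        (\<exists>n \<alpha>. type_A_numbering R \<Delta> n \<alpha> \<and>
           (J = (\<lambda>i. reflection R (\<alpha> i)) ` {1..n - 1} \<or>
            J = (\<lambda>i. reflection R (\<alpha> i)) ` {2..n})))"
proof -
  interpret based_roots R \<Delta>
    using assms(1,2) by unfold_locales (auto simp: irreducible_root_system_def)
  have J: "J \<subseteq> S" using assms(3) by (simp add: simple_reflections_def)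
  have P: "parabolic R J = words J"
    using J base_root by (intro parabolic_eq_words) auto
  have "J \<noteq> S" using assms(4) P carrier_weyl_group W_eq_words_simple by auto
  then obtain k where k: "k \<in> \<Delta>" "refl k \<notin> J" using J by blast
  interpret weight_orbit R \<Delta> k
    using assms(1) k by unfold_locales
  let ?c = "card (lcosets\<^bsub>weyl_group R\<^esub> words J)"
  have ge: "dim (UNIV :: 'a set) + 1 \<le> ?c"
    using card_orbit_ge card_orbit_le_cosets[OF J k(2)] by linarith
  have "\<exists>n \<alpha>. type_A_numbering R \<Delta> n \<alpha> \<and>
           (J = (\<lambda>i. refl (\<alpha> i)) ` {1..n - 1} \<or> J = (\<lambda>i. refl (\<alpha> i)) ` {2..n})"
    if eq: "?c = dim (UNIV :: 'a set) + 1"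
  proof -
    have card_orbit: "card orbit = dim (UNIV :: 'a set) + 1"
      using eq card_orbit_ge card_orbit_le_cosets[OF J k(2)] by linarith
    interpret minimal_orbit R \<Delta> k
      using card_orbit by unfold_locales
    have "refl b \<in> J" if b: "b \<in> \<Delta>" "b \<noteq> k" for b
    proof -
      have "coord k \<circ> refl b = coord k"
        using coord_base[OF b(1), of k] b(2) by (auto simp: form_refl[OF linear_coord])
      moreover have "refl b \<in> W" using b base_root by (intro letter_in_words) auto
      ultimately have "refl b \<in> words J"
        using stabilizer_if_few_cosets[OF J k(2)] eq card_orbit by simp
      then show ?thesis using simple_in_parabolic[OF J b(1)] by blast
    qed
    then have "J = refl ` (\<Delta> - {k})" using J k by blast
    also have "\<Delta> - {k} = step ` {2..card \<Delta>}"
    proof -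
      have "card \<Delta> > 0" using k finite_base card_gt_0_iff by blast
      then have "{1..card \<Delta>} = insert 1 {2..card \<Delta>}" by auto
      moreover have "step ` {1..card \<Delta>} = \<Delta>" "inj_on step {1..card \<Delta>}"
        using bij_step by (auto simp: bij_betw_def)
      ultimately have "\<Delta> = insert k (step ` {2..card \<Delta>})" "k \<notin> step ` {2..card \<Delta>}"
        using step_1 by (auto simp: inj_on_def)
      then show ?thesis by blast
    qed
    finally have "J = (\<lambda>i. refl (step i)) ` {2..card \<Delta>}" by (simp add: image_image)
    then show ?thesis using step_numbering by blast
  qed
  moreover have "?c = dim (UNIV :: 'a set) + 1"
    if num: "type_A_numbering R \<Delta> n \<alpha>"
      and J': "J = (\<lambda>i. refl (\<alpha> i)) ` {1..n - 1} \<or> J = (\<lambda>i. refl (\<alpha> i)) ` {2..n}" for n \<alpha>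
  proof -
    have "dim (UNIV :: 'a set) = n"
      using num bij_betw_same_card[of \<alpha> "{1..n}" \<Delta>] dim_base by (simp add: type_A_numbering_def)
    moreover have "?c \<le> n + 1"
      using J'
    proof
      assume "J = (\<lambda>i. refl (\<alpha> i)) ` {2..n}"
      then show ?thesis using card_cosets_type_A[OF num] by simp
    next
      \<comment> \<open>The first \<open>n - 1\<close> nodes are the last \<open>n - 1\<close> ones of the reversed numbering.\<close>
      have "{1..n - 1} = (\<lambda>i. n + 1 - i) ` {2..n}"
      proof (intro equalityI subsetI)
        fix i assume "i \<in> {1..n - 1}"
        then show "i \<in> (\<lambda>i. n + 1 - i) ` {2..n}" by (intro image_eqI[of _ _ "n + 1 - i"]) auto
      qed auto
      moreover assume "J = (\<lambda>i. refl (\<alpha> i)) ` {1..n - 1}"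
      ultimately have "J = (\<lambda>i. refl (\<alpha> (n + 1 - i))) ` {2..n}" by (simp add: image_image)
      then show ?thesis using card_cosets_type_A[OF type_A_numbering_reverse[OF num]] by simp
    qed
    ultimately show ?thesis using ge by simp
  qed
  ultimately show ?thesis using ge unfolding P by blast
qed

end
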